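(* Let $a\ge2$ and $b\ge1$ be integers, and let $\Delta_{n,k}$ denote the number of vertices of the Horadam cube $\Pi^{a,b}_n$ with exactly $k$ neighbors. Then for all $n\ge2$ and all $k\ge 0$, $$\Delta_{n,k}=2\Delta_{n-1,k-1}+(a-2)\Delta_{n-1,k-2}+\Delta_{n-2,k-1}+(b-2)\Delta_{n-2,k-2}+\Delta_{n-2,k-3},$$ with initial values $\Delta_{0,0}=1$, $\Delta_{1,1}=2$ and $\Delta_{1,2}=a-2$ (all other $\Delta_{0,k}$ and $\Delta_{1,k}$ being $0$).
   Context: For integers $a,b\ge1$ and $n\ge 0$, $\mathcal S^{a,b}_n$ is the set of all strings of length $n$ over the alphabet $\{0,1,\dots,a+b-1\}$ in which every letter from $\{a,\dots,a+b-1\}$ appears only immediately after a letter $0$; $\mathcal S^{a,b}_0$ contains only the empty string. The Horadam cube $\Pi^{a,b}_n$ is the simple graph with vertex set $\mathcal S^{a,b}_n$ in which $x_1\cdots x_n$ and $y_1\cdots y_n$ are adjacent if and only if $\sum_{i=1}^n|x_i-y_i|=1$. By convention $\Delta_{n,k}=0$ for $k<0$. *)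

theory Defs
  imports "Graph_Theory.Pair_Digraph"
begin

text \<open>Positions are numbered from 0, so the letter preceding position \<open>i\<close> exists iff \<open>i > 0\<close>.\<close>

definition horadam_strings :: "nat \<Rightarrow> nat \<Rightarrow> nat \<Rightarrow> nat list set" where
  "horadam_strings a b n =
     {x. length x = n \<and> set x \<subseteq> {0..<a + b} \<and>
         (\<forall>i<n. x ! i \<in> {a..<a + b} \<longrightarrow> 0 < i \<and> x ! (i - 1) = 0)}"

text \<open>A simple graph is represented as a symmetric loop-free digraph (locale \<open>pair_graph\<close>):
  each edge is present as the two ordered pairs of its ends.\<close>

definition horadam_cube :: "nat \<Rightarrow> nat \<Rightarrow> nat \<Rightarrow> nat list pair_pre_digraph" where
  "horadam_cube a b n =
     \<lparr> pverts = horadam_strings a b n,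
       parcs = {(x, y). x \<in> horadam_strings a b n \<and> y \<in> horadam_strings a b n \<and>
                        (\<Sum>i<n. \<bar>int (x ! i) - int (y ! i)\<bar>) = 1} \<rparr>"

lemma finite_horadam_strings: "finite (horadam_strings a b n)"
proof (rule finite_subset)
  show "horadam_strings a b n \<subseteq> {x. set x \<subseteq> {0..<a + b} \<and> length x = n}"
    by (auto simp: horadam_strings_def)
  show "finite {x. set x \<subseteq> {0..<a + b} \<and> length x = n}"
    by (rule finite_lists_length_eq) simp
qed

lemma pair_graph_horadam_cube: "pair_graph (horadam_cube a b n)"
proof
  show "finite (pverts (horadam_cube a b n))"
    by (simp add: horadam_cube_def finite_horadam_strings)
  have "parcs (horadam_cube a b n) \<subseteq> horadam_strings a b n \<times> horadam_strings a b n"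
    by (auto simp: horadam_cube_def)
  then show "finite (parcs (horadam_cube a b n))"
    by (rule finite_subset) (simp add: finite_horadam_strings)
  show "symmetric (with_proj (horadam_cube a b n))"
    by (auto simp: symmetric_def sym_def horadam_cube_def abs_minus_commute)
qed (auto simp: horadam_cube_def)

text \<open>The index \<open>k\<close> is an integer, so that the value is 0 for negative \<open>k\<close>.\<close>

definition horadam_deg_count :: "nat \<Rightarrow> nat \<Rightarrow> nat \<Rightarrow> int \<Rightarrow> nat" where
  "horadam_deg_count a b n k =
     card {x \<in> pverts (horadam_cube a b n).
             int (card {y. x \<rightarrow>\<^bsub>with_proj (horadam_cube a b n)\<^esub> y}) = k}"

lemma horadam_deg_count_neg: "k < 0 \<Longrightarrow> horadam_deg_count a b n k = 0"
  unfolding horadam_deg_count_def by (subst card_eq_0_iff) auto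

end

theory Submission
  imports Defs
begin

text \<open>Split a string at its first letter. Changing one letter of \<open>c w\<close> by one changes either \<open>c\<close> or
  \<open>w\<close>, so its degree is the degree of \<open>w\<close> plus the number of admissible moves of \<open>c\<close>. Two
  interactions between neighbouring letters occur: after a leading \<open>0\<close> the letter \<open>a - 1\<close> may rise
  to \<open>a\<close>, and a \<open>0\<close> may rise only if the next letter is below \<open>a\<close>. Counting by degree the tails of
  strings with leading \<open>0\<close> separately gives two coupled recurrences, and eliminating the auxiliary
  count yields the claim.\<close>

text \<open>The flag \<open>z\<close> tells whether the string is preceded by a letter \<open>0\<close>.\<close>

fun admissible :: "nat \<Rightarrow> nat \<Rightarrow> bool \<Rightarrow> nat list \<Rightarrow> bool" where
  "admissible a b z [] \<longleftrightarrow> True"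
| "admissible a b z (c # w) \<longleftrightarrow> c < (if z then a + b else a) \<and> admissible a b (c = 0) w"

lemma admissible_iff_nth:
  "admissible a b z x \<longleftrightarrow> set x \<subseteq> {0..<a + b} \<and>
     (\<forall>i<length x. a \<le> x ! i \<longrightarrow> (0 < i \<or> z) \<and> (0 < i \<longrightarrow> x ! (i - 1) = 0))"
proof (induction x arbitrary: z)
  case (Cons c w)
  \<comment> \<open>The predecessor of position \<open>i\<close> in \<open>w\<close> is
    \<open>(c # w) ! i\<close>; for \<open>i = 0\<close> it is \<open>c\<close>, which is what the
    flag \<open>c = 0\<close> records.\<close>
  have "(\<forall>i<length w. a \<le> w ! i \<longrightarrow> (0 < i \<or> c = 0) \<and> (0 < i \<longrightarrow> w ! (i - 1) = 0)) \<longleftrightarrow>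
        (\<forall>i<length w. a \<le> w ! i \<longrightarrow> (c # w) ! i = 0)"
    by (intro iff_allI imp_cong refl) (simp add: nth_Cons')
  then show ?case
    by (auto simp: Cons.IH All_less_Suc2)
qed simp

lemma horadam_strings_eq: "horadam_strings a b n = {x. length x = n \<and> admissible a b False x}"
proof (intro set_eqI)
  fix x :: "nat list"
  \<comment> \<open>Lets the test \<open>x ! i \<in> {a..<a + b}\<close> shrink to
    \<open>a \<le> x ! i\<close>.\<close>
  have "x ! i < a + b" if "set x \<subseteq> {0..<a + b}" "i < length x" for i
    using that nth_mem by fastforce
  then show "x \<in> horadam_strings a b n \<longleftrightarrow> x \<in> {x. length x = n \<and> admissible a b False x}"
    by (auto simp: horadam_strings_def admissible_iff_nth)
qed

lemma admissible_mono: "admissible a b False w \<Longrightarrow> admissible a b z w"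
  by (cases w) auto

definition l1_dist :: "nat list \<Rightarrow> nat list \<Rightarrow> int" where
  "l1_dist x y = (\<Sum>i<length x. \<bar>int (x ! i) - int (y ! i)\<bar>)"

lemma l1_dist_Cons: "l1_dist (c # w) (d # v) = \<bar>int c - int d\<bar> + l1_dist w v"
  by (simp add: l1_dist_def sum.lessThan_Suc_shift del: sum.lessThan_Suc)

lemma l1_dist_nonneg: "0 \<le> l1_dist x y"
  by (simp add: l1_dist_def sum_nonneg)

lemma l1_dist_eq_0_iff: "length x = length y \<Longrightarrow> l1_dist x y = 0 \<longleftrightarrow> x = y"
  by (auto simp: l1_dist_def sum_nonneg_eq_0_iff intro: nth_equalityI)

definition nbrs :: "nat \<Rightarrow> nat \<Rightarrow> bool \<Rightarrow> nat list \<Rightarrow> nat list set" where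
  "nbrs a b z x = {y. length y = length x \<and> admissible a b z y \<and> l1_dist x y = 1}"

lemma finite_admissible: "finite {x. length x = n \<and> admissible a b z x}"
proof (rule finite_subset)
  show "{x. length x = n \<and> admissible a b z x} \<subseteq> {x. set x \<subseteq> {0..<a + b} \<and> length x = n}"
    by (auto simp: admissible_iff_nth)
qed (simp add: finite_lists_length_eq)

lemma finite_nbrs: "finite (nbrs a b z x)"
  by (rule finite_subset[OF _ finite_admissible[of "length x" a b z]]) (auto simp: nbrs_def)

lemma horadam_deg_count_eq:
  "horadam_deg_count a b n k =
     card {x. length x = n \<and> admissible a b False x \<and> int (card (nbrs a b False x)) = k}"
proof -
  have "{y. x \<rightarrow>\<^bsub>with_proj (horadam_cube a b n)\<^esub> y} = nbrs a b False x"
    if "x \<in> horadam_strings a b n" for x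
    using that by (auto simp: horadam_cube_def nbrs_def horadam_strings_eq l1_dist_def)
  then show ?thesis
    unfolding horadam_deg_count_def
    by (intro arg_cong[where f = card]) (auto simp: horadam_cube_def horadam_strings_eq)
qed

definition first_moves :: "nat \<Rightarrow> nat \<Rightarrow> bool \<Rightarrow> nat \<Rightarrow> nat list \<Rightarrow> nat set" where
  "first_moves a b z c w = {d. \<bar>int c - int d\<bar> = 1 \<and> admissible a b z (d # w)}"

text \<open>Lowering a positive \<open>c\<close> is always possible: the bound on it still holds,
  and reaching \<open>0\<close> only frees the next letter. Raising \<open>c\<close> must respect
  the bound set by \<open>z\<close>, and raising \<open>0\<close> takes away the licence for a
  letter from \<open>a\<close> on at the head of \<open>w\<close>.\<close>

lemma first_moves_eq:
  assumes "admissible a b z (c # w)"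
  shows "first_moves a b z c w =
    (if 0 < c then {c - 1} else {}) \<union>
    (if Suc c < (if z then a + b else a) \<and> (0 < c \<or> admissible a b False w) then {Suc c} else {})"
proof -
  have step: "\<bar>int c - int d\<bar> = 1 \<longleftrightarrow> 0 < c \<and> d = c - 1 \<or> d = Suc c" for d
    by auto
  have down: "admissible a b z ((c - 1) # w)" if "0 < c"
    using assms that by (auto intro: admissible_mono)
  have up: "admissible a b z (Suc c # w) \<longleftrightarrow>
      Suc c < (if z then a + b else a) \<and> (0 < c \<or> admissible a b False w)"
    using assms by auto
  show ?thesis
    unfolding first_moves_def step up[symmetric]
    using down by (auto simp del: admissible.simps)
qed

lemma card_first_moves:
  assumes "admissible a b z (c # w)"
  shows "card (first_moves a b z c w) = of_bool (0 < c) +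
    of_bool (Suc c < (if z then a + b else a) \<and> (0 < c \<or> admissible a b False w))"
  unfolding first_moves_eq[OF assms] by auto

lemma nbrs_Cons:
  assumes "admissible a b z (c # w)"
  shows "nbrs a b z (c # w) =
    (\<lambda>d. d # w) ` first_moves a b z c w \<union> (#) c ` nbrs a b (c = 0) w"
proof (intro set_eqI)
  fix y
  show "y \<in> nbrs a b z (c # w) \<longleftrightarrow>
    y \<in> (\<lambda>d. d # w) ` first_moves a b z c w \<union> (#) c ` nbrs a b (c = 0) w"
  proof (cases y)
    case Nil
    then show ?thesis by (auto simp: nbrs_def)
  next
    case (Cons d v)
    \<comment> \<open>Two nonnegative integers add up to 1 only as 1 + 0 or 0 + 1, and distance 0
      means equality.\<close>
    have "\<bar>int c - int d\<bar> + l1_dist w v = 1 \<longleftrightarrow>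
        \<bar>int c - int d\<bar> = 1 \<and> w = v \<or> c = d \<and> l1_dist w v = 1" if "length v = length w"
      using l1_dist_nonneg[of w v] l1_dist_eq_0_iff[of w v] that by auto
    then show ?thesis
      using assms l1_dist_eq_0_iff[of w w]
      by (auto simp: Cons nbrs_def first_moves_def l1_dist_Cons)
  qed
qed

lemma card_nbrs_Cons:
  assumes "admissible a b z (c # w)"
  shows "card (nbrs a b z (c # w)) = of_bool (0 < c) +
    of_bool (Suc c < (if z then a + b else a) \<and> (0 < c \<or> admissible a b False w)) +
    card (nbrs a b (c = 0) w)"
proof -
  have "finite (first_moves a b z c w)"
    unfolding first_moves_eq[OF assms] by auto
  \<comment> \<open>Moves in the first set change the first letter, those in the second keep
    it.\<close>
  moreover have "(\<lambda>d. d # w) ` first_moves a b z c w \<inter> (#) c ` nbrs a b (c = 0) w = {}"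
    by (auto simp: first_moves_def)
  ultimately have "card (nbrs a b z (c # w)) =
      card (first_moves a b z c w) + card (nbrs a b (c = 0) w)"
    unfolding nbrs_Cons[OF assms]
    by (simp add: card_Un_disjoint finite_nbrs card_image inj_on_def)
  then show ?thesis
    by (simp only: card_first_moves[OF assms])
qed

lemma card_length_Suc:
  fixes P :: "nat list \<Rightarrow> bool"
  assumes "\<And>c w. P (c # w) \<Longrightarrow> c < m"
    and "finite {x. length x = Suc n \<and> P x}"
  shows "card {x. length x = Suc n \<and> P x} = (\<Sum>c<m. card {w. length w = n \<and> P (c # w)})"
proof -
  let ?W = "\<lambda>c. {w. length w = n \<and> P (c # w)}"
  have eq: "{x. length x = Suc n \<and> P x} = (\<Union>c<m. (#) c ` ?W c)"
    using assms(1) by (auto simp: length_Suc_conv)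
  have "finite ((#) c ` ?W c)" for c
    by (rule finite_subset[OF _ assms(2)]) auto
  then have "card (\<Union>c<m. (#) c ` ?W c) = (\<Sum>c<m. card ((#) c ` ?W c))"
    by (intro card_UN_disjoint) auto
  then show ?thesis
    unfolding eq by (simp add: card_image)
qed

text \<open>Counts the strings \<open>0 w\<close> of length \<open>n + 1\<close> by their degree, expressed in terms of \<open>w\<close>.\<close>

definition zero_count :: "nat \<Rightarrow> nat \<Rightarrow> nat \<Rightarrow> int \<Rightarrow> nat" where
  "zero_count a b n k = card {w. length w = n \<and> admissible a b True w \<and>
     of_bool (admissible a b False w) + int (card (nbrs a b True w)) = k}"

text \<open>Sort by the first letter: \<open>0\<close> gives \<open>zero_count\<close>,
  \<open>a - 1\<close> can only fall and adds 1 to the degree of the tail, and each of the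
  \<open>a - 2\<close> letters between has both moves and adds 2.\<close>

lemma horadam_deg_count_Suc:
  assumes "2 \<le> a"
  shows "int (horadam_deg_count a b (Suc n) k) = int (zero_count a b n k)
    + (int a - 2) * int (horadam_deg_count a b n (k - 2)) + int (horadam_deg_count a b n (k - 1))"
proof -
  let ?P = "\<lambda>x. admissible a b False x \<and> int (card (nbrs a b False x)) = k"
  let ?f = "\<lambda>c. card {w. length w = n \<and> ?P (c # w)}"
  have "horadam_deg_count a b (Suc n) k = (\<Sum>c<a. ?f c)"
    unfolding horadam_deg_count_eq
    by (rule card_length_Suc)
       (auto intro: finite_subset[OF _ finite_admissible[of "Suc n" a b False]])
  \<comment> \<open>Since \<open>a \<ge> 2\<close>, the extreme letters \<open>0\<close> and
    \<open>a - 1\<close> are distinct.\<close>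
  also have "{..<a} = insert 0 (insert (a - 1) {1..<a - 1})"
    using assms by auto
  also have "sum ?f \<dots> = ?f 0 + ?f (a - 1) + (\<Sum>c = 1..<a - 1. ?f c)"
    using assms by (simp add: sum.insert_if)
  also have "?f 0 = zero_count a b n k"
    unfolding zero_count_def using assms
    by (intro arg_cong[where f = card]) (auto simp: card_nbrs_Cons)
  also have "?f (a - 1) = horadam_deg_count a b n (k - 1)"
    unfolding horadam_deg_count_eq using assms
    by (intro arg_cong[where f = card]) (auto simp: card_nbrs_Cons)
  also have "(\<Sum>c = 1..<a - 1. ?f c) = (\<Sum>c = 1..<a - 1. horadam_deg_count a b n (k - 2))"
    unfolding horadam_deg_count_eq using assms
    by (intro sum.cong refl arg_cong[where f = card]) (auto simp: card_nbrs_Cons)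
  finally show ?thesis
    using assms by (simp add: of_nat_diff)
qed

text \<open>Sort the strings \<open>0 c w\<close> by \<open>c\<close>. The leading \<open>0\<close>
  can rise iff \<open>c < a\<close>. For \<open>c = 0\<close> this adds 1 to the degree of
  \<open>0 w\<close>; for \<open>0 < c < a\<close> it joins the two moves of \<open>c\<close>,
  making 3. For \<open>c \<ge> a\<close> only the moves of \<open>c\<close> count: one for the top
  letter, otherwise two.\<close>

lemma zero_count_Suc:
  assumes "2 \<le> a" and "1 \<le> b"
  shows "int (zero_count a b (Suc n) k) = int (zero_count a b n (k - 1))
    + (int a - 1) * int (horadam_deg_count a b n (k - 3))
    + (int b - 1) * int (horadam_deg_count a b n (k - 2)) + int (horadam_deg_count a b n (k - 1))"
proof -
  let ?P = "\<lambda>w. admissible a b True w \<and>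
    of_bool (admissible a b False w) + int (card (nbrs a b True w)) = k"
  let ?f = "\<lambda>c. card {w. length w = n \<and> ?P (c # w)}"
  have "zero_count a b (Suc n) k = (\<Sum>c<a + b. ?f c)"
    unfolding zero_count_def
    by (rule card_length_Suc)
       (auto intro: finite_subset[OF _ finite_admissible[of "Suc n" a b True]])
  also have "{..<a + b} = insert 0 (insert (a + b - 1) ({1..<a} \<union> {a..<a + b - 1}))"
    using assms by auto
  also have "sum ?f \<dots> = ?f 0 + ?f (a + b - 1) + (\<Sum>c = 1..<a. ?f c) + (\<Sum>c = a..<a + b - 1. ?f c)"
    using assms by (auto simp: sum.insert_if sum.union_disjoint)
  also have "?f 0 = zero_count a b n (k - 1)"
    unfolding zero_count_def using assms
    by (intro arg_cong[where f = card]) (auto simp: card_nbrs_Cons)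
  also have "?f (a + b - 1) = horadam_deg_count a b n (k - 1)"
    unfolding horadam_deg_count_eq using assms
    by (intro arg_cong[where f = card]) (auto simp: card_nbrs_Cons)
  \<comment> \<open>Even \<open>c = a - 1\<close> has both moves here, because
    \<open>b \<ge> 1\<close> and the preceding \<open>0\<close> allow \<open>a\<close>.\<close>
  also have "(\<Sum>c = 1..<a. ?f c) = (\<Sum>c = 1..<a. horadam_deg_count a b n (k - 3))"
    unfolding horadam_deg_count_eq using assms
    by (intro sum.cong refl arg_cong[where f = card]) (auto simp: card_nbrs_Cons)
  also have "(\<Sum>c = a..<a + b - 1. ?f c) = (\<Sum>c = a..<a + b - 1. horadam_deg_count a b n (k - 2))"
    unfolding horadam_deg_count_eq using assms
    by (intro sum.cong refl arg_cong[where f = card]) (auto simp: card_nbrs_Cons)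
  finally show ?thesis
    using assms by (simp add: of_nat_diff)
qed

lemma nbrs_Nil: "nbrs a b z [] = {}"
  by (simp add: nbrs_def l1_dist_def)

lemma horadam_deg_count_0: "horadam_deg_count a b 0 k = of_bool (k = 0)"
proof -
  have "{x. length x = 0 \<and> admissible a b False x \<and> int (card (nbrs a b False x)) = k} =
      (if k = 0 then {[]} else {})"
    by (auto simp: nbrs_Nil)
  then show ?thesis
    unfolding horadam_deg_count_eq by simp
qed

lemma zero_count_0: "zero_count a b 0 k = of_bool (k = 1)"
proof -
  have "{w. length w = 0 \<and> admissible a b True w \<and>
      of_bool (admissible a b False w) + int (card (nbrs a b True w)) = k} =
      (if k = 1 then {[]} else {})"
    by (auto simp: nbrs_Nil)
  then show ?thesis
    unfolding zero_count_def by simp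
qed

text \<open>The first recurrence at \<open>n\<close> and \<open>k - 1\<close> is solved for
  \<open>zero_count a b n (k - 1)\<close>. Substitution doubles the term at \<open>Suc n\<close> and
  \<open>k - 1\<close>, and lowers \<open>b - 1\<close> to \<open>b - 2\<close> and
  \<open>a - 1\<close> to \<open>(a - 1) - (a - 2) = 1\<close>.\<close>

lemma horadam_deg_count_Suc_Suc:
  assumes "2 \<le> a" and "1 \<le> b"
  shows "int (horadam_deg_count a b (Suc (Suc n)) k) =
      2 * int (horadam_deg_count a b (Suc n) (k - 1))
    + (int a - 2) * int (horadam_deg_count a b (Suc n) (k - 2))
    + int (horadam_deg_count a b n (k - 1))
    + (int b - 2) * int (horadam_deg_count a b n (k - 2))
    + int (horadam_deg_count a b n (k - 3))"
  using horadam_deg_count_Suc[OF assms(1), of b "Suc n" k] zero_count_Suc[OF assms, of n k]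
    horadam_deg_count_Suc[OF assms(1), of b n "k - 1"]
  by (simp add: algebra_simps)

theorem theorem11:
  fixes a b :: nat
  assumes "2 \<le> a" and "1 \<le> b"
  defines "\<Delta> \<equiv> (\<lambda>n k. int (horadam_deg_count a b n k))"
  shows "(\<forall>n k. 2 \<le> n \<longrightarrow> 0 \<le> k \<longrightarrow>
            \<Delta> n k = 2 * \<Delta> (n - 1) (k - 1) + (int a - 2) * \<Delta> (n - 1) (k - 2)
                  + \<Delta> (n - 2) (k - 1) + (int b - 2) * \<Delta> (n - 2) (k - 2)
                  + \<Delta> (n - 2) (k - 3)) \<and>
         \<Delta> 0 0 = 1 \<and> \<Delta> 1 1 = 2 \<and> \<Delta> 1 2 = int a - 2 \<and>
         (\<forall>k. k \<noteq> 0 \<longrightarrow> \<Delta> 0 k = 0) \<and>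
         (\<forall>k. k \<noteq> 1 \<and> k \<noteq> 2 \<longrightarrow> \<Delta> 1 k = 0)"
proof (intro conjI allI impI)
  fix n :: nat and k :: int
  assume "2 \<le> n"
  then obtain m where "n = Suc (Suc m)"
    by (metis add_2_eq_Suc le_Suc_ex)
  then show "\<Delta> n k = 2 * \<Delta> (n - 1) (k - 1) + (int a - 2) * \<Delta> (n - 1) (k - 2)
      + \<Delta> (n - 2) (k - 1) + (int b - 2) * \<Delta> (n - 2) (k - 2) + \<Delta> (n - 2) (k - 3)"
    unfolding \<Delta>_def using horadam_deg_count_Suc_Suc[OF assms(1,2), of m k] by simp
\<comment> \<open>Length 1 is the first recurrence at \<open>n = 0\<close>, where
  \<open>zero_count\<close> is concentrated at 1 and the count for the empty string at 0.\<close>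
qed (simp_all add: \<Delta>_def horadam_deg_count_0 horadam_deg_count_Suc[OF assms(1), of b 0, simplified]
      zero_count_0)

end
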